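(* Let $n=pq^{b}$, where $p$ and $q$ are distinct primes and $b\geq 2$ is an integer. Then $$\alpha\bigl(\Theta(\mathbb{Z}_n)\bigr)=n-\min\bigl\{pq,\; q^{b}+p-1\bigr\}.$$
   Context: $\mathbb{Z}_n$ denotes the cyclic group of order $n$. For a finite group $G$, $|g|$ denotes the order of $g\in G$, and the prime-coprime graph $\Theta(G)$ is the simple graph with vertex set $G$ in which two distinct vertices $g,h$ are adjacent if and only if $\gcd(|g|,|h|)$ is either $1$ or a prime. The independence number $\alpha(\Gamma)$ of a graph $\Gamma$ is the maximum cardinality of an independent set of $\Gamma$. *)

theory Defs
  imports "HOL-Algebra.Elementary_Groups" "HOL-Algebra.Multiplicative_Group" "HOL-Computational_Algebra.Primes"
    "Graph_Theory.Pair_Digraph"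
begin

text \<open>Simple graphs are represented, as in the locale \<^locale>\<open>pair_graph\<close>, by symmetric irreflexive
  arc relations.\<close>

definition prime_coprime_graph :: "('a, 'm) monoid_scheme \<Rightarrow> 'a pair_pre_digraph" where
  "prime_coprime_graph G =
     \<lparr> pverts = carrier G,
       parcs = {(g, h). g \<in> carrier G \<and> h \<in> carrier G \<and> g \<noteq> h \<and>
                  (gcd (group.ord G g) (group.ord G h) = 1 \<or>
                   prime (gcd (group.ord G g) (group.ord G h)))} \<rparr>"

lemma pair_graph_prime_coprime_graph:
  assumes "finite (carrier G)"
  shows "pair_graph (prime_coprime_graph G)"
proof -
  have "finite (parcs (prime_coprime_graph G))"
    by (rule finite_subset[of _ "carrier G \<times> carrier G"])
       (auto simp: prime_coprime_graph_def assms)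
  then show ?thesis
    using assms
    by unfold_locales
       (auto simp: prime_coprime_graph_def symmetric_def gcd.commute intro!: symI)
qed

definition independent_set :: "'a pair_pre_digraph \<Rightarrow> 'a set \<Rightarrow> bool" where
  "independent_set \<Gamma> S \<longleftrightarrow>
     S \<subseteq> pverts \<Gamma> \<and> (\<forall>u\<in>S. \<forall>v\<in>S. (u, v) \<notin> parcs \<Gamma>)"

text \<open>Meaningful for graphs with finitely many vertices: the set below is then finite, and it
  contains \<open>0\<close> because the empty set is independent.\<close>

definition independence_number :: "'a pair_pre_digraph \<Rightarrow> nat" where
  "independence_number \<Gamma> = Max {card S | S. independent_set \<Gamma> S}"

end

theory Submission
  imports Defs
begin

text \<open>An element whose order divides \<open>p\<close> or \<open>q\<close> is adjacent to all others, so an independent set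
  containing one is a singleton. Among the remaining orders, the multiples of \<open>q\<^sup>2\<close> pairwise have
  composite gcd, and so do the multiples of \<open>p * q\<close>; but if one order divides \<open>p * q\<close> and the other
  is not a multiple of \<open>p * q\<close>, then their gcd divides \<open>p\<close> or \<open>q\<close>. Hence a maximum independent set
  consists of all elements whose order does not divide \<open>p * q\<close>, or of all those whose order divides
  neither \<open>p\<close> nor \<open>q ^ b\<close>. Both complements are counted using that \<open>\<int>\<^sub>n\<close> has exactly \<open>d\<close> elements
  of order dividing \<open>d\<close>, for each divisor \<open>d\<close> of \<open>n\<close>.\<close>

lemma ord_dvd_iff_integer_mod_group:
  assumes "x \<in> carrier (integer_mod_group n)"
  shows "group.ord (integer_mod_group n) x dvd k \<longleftrightarrow> int n dvd int k * x"
proof -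
  interpret group "integer_mod_group n" by simp
  show ?thesis
    using pow_eq_id[OF assms, of k] by (simp add: dvd_eq_mod_eq_0)
qed

text \<open>With \<open>n = d * k\<close>, the criterion \<open>n dvd d * x\<close> becomes
  \<open>k dvd x\<close>, and exactly \<open>d\<close> multiples of \<open>k\<close> lie in
  \<open>{0..<n}\<close>.\<close>

lemma card_ord_dvd_integer_mod_group:
  assumes "n > 0" and "d dvd n"
  shows "card {x \<in> carrier (integer_mod_group n). group.ord (integer_mod_group n) x dvd d} = d"
proof -
  from assms obtain k where n: "n = d * k" and d: "d > 0" and k: "k > 0"
    by (auto elim!: dvdE)
  have "{x \<in> carrier (integer_mod_group n). group.ord (integer_mod_group n) x dvd d} =
      {x \<in> {0..<int n}. int k dvd x}"
    using d k by (auto simp: ord_dvd_iff_integer_mod_group n carrier_integer_mod_group)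
  also have "\<dots> = (\<lambda>i. int k * int i) ` {..<d}"
  proof (intro equalityI subsetI)
    fix x assume x: "x \<in> {x \<in> {0..<int n}. int k dvd x}"
    then obtain m where m: "x = int k * m" by auto
    have "m \<ge> 0" using x m k by (auto simp: zero_le_mult_iff)
    moreover have "m < int d" using x m k by (auto simp: n mult.commute)
    ultimately show "x \<in> (\<lambda>i. int k * int i) ` {..<d}"
      using m by (intro image_eqI[of _ _ "nat m"]) auto
  next
    fix x assume "x \<in> (\<lambda>i. int k * int i) ` {..<d}"
    then obtain i where i: "x = int k * int i" "i < d" by auto
    then have "int i * int k < int d * int k"
      using k by (intro mult_strict_right_mono) auto
    then show "x \<in> {x \<in> {0..<int n}. int k dvd x}"
      using i by (simp add: n mult.commute)
  qed
  also have "card \<dots> = card {..<d}"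
    using k by (intro card_image) (auto simp: inj_on_def)
  finally show ?thesis by simp
qed

lemma dvd_prime_times_primepowE:
  fixes p q d :: nat
  assumes "prime p" and "prime q" and "d dvd p * q ^ b"
  obtains a i where "d = a * q ^ i" and "a = 1 \<or> a = p" and "i \<le> b"
proof -
  from division_decomp[OF assms(3)] obtain a c where "d = a * c" "a dvd p" "c dvd q ^ b"
    by auto
  moreover from this obtain i where "i \<le> b" "c = q ^ i"
    using divides_primepow_nat[OF assms(2)] by auto
  moreover have "a = 1 \<or> a = p"
    using \<open>a dvd p\<close> assms(1) by (simp add: prime_nat_iff)
  ultimately show thesis using that by blast
qed

text \<open>The gcd of two such orders is again a multiple of \<open>r * s\<close>, a product of two
  non-units, so it is neither 1 nor prime. The case \<open>r = s\<close> is allowed.\<close>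

lemma independent_prime_coprime_graph_dvd:
  assumes "S \<subseteq> carrier G" and "\<And>x. x \<in> S \<Longrightarrow> r * s dvd group.ord G x" and "r > 1" and "s > 1"
  shows "independent_set (prime_coprime_graph G) S"
  unfolding independent_set_def
proof (intro conjI ballI)
  show "S \<subseteq> pverts (prime_coprime_graph G)"
    using assms(1) by (simp add: prime_coprime_graph_def)
next
  fix u v assume "u \<in> S" "v \<in> S"
  then have "r * s dvd gcd (group.ord G u) (group.ord G v)"
    using assms(2) by simp
  moreover have "\<not> (g = 1 \<or> prime g)" if "r * s dvd g" for g :: nat
  proof
    assume g: "g = 1 \<or> prime g"
    have "r * s \<noteq> 1"
      using assms(3) by simp
    with that have "g \<noteq> 1" and "prime g \<Longrightarrow> g = r * s"
      by (auto simp: prime_nat_iff)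
    with g have "prime (r * s)" by blast
    then have "r = 1 \<or> s = 1" by (rule prime_product)
    then show False using assms(3,4) by simp
  qed
  ultimately show "(u, v) \<notin> parcs (prime_coprime_graph G)"
    by (simp add: prime_coprime_graph_def del: gcd_greatest_iff)
qed

text \<open>A divisor of a prime is 1 or that prime, so distinct \<open>u\<close> and
  \<open>v\<close> would be adjacent.\<close>

lemma independent_setD_prime_coprime_graph:
  assumes "independent_set (prime_coprime_graph G) S" and "u \<in> S" and "v \<in> S"
    and "prime r" and "gcd (group.ord G u) (group.ord G v) dvd r"
  shows "u = v"
proof (rule ccontr)
  assume "u \<noteq> v"
  moreover have "gcd (group.ord G u) (group.ord G v) = 1 \<or> prime (gcd (group.ord G u) (group.ord G v))"
    using assms(4,5) by (metis prime_nat_iff)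
  ultimately show False
    using assms(1-3) by (auto simp: independent_set_def prime_coprime_graph_def)
qed

lemma independence_number_eqI:
  assumes "finite (pverts \<Gamma>)" and "independent_set \<Gamma> S"
    and "\<And>T. independent_set \<Gamma> T \<Longrightarrow> card T \<le> card S"
  shows "independence_number \<Gamma> = card S"
  unfolding independence_number_def
proof (rule Max_eqI)
  have "{card S |S. independent_set \<Gamma> S} \<subseteq> card ` Pow (pverts \<Gamma>)"
    by (auto simp: independent_set_def)
  then show "finite {card S |S. independent_set \<Gamma> S}"
    using assms(1) by (meson finite_Pow_iff finite_imageI finite_subset)
qed (use assms(2,3) in auto)

theorem proposition3p14:
  fixes p q b n :: nat
  assumes "prime p" and "prime q" and "p \<noteq> q" and "b \<ge> 2" and "n = p * q ^ b"
  shows "int (independence_number (prime_coprime_graph (integer_mod_group n))) =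
           int n - min (int p * int q) (int q ^ b + int p - 1)"
proof -
  define G where "G = integer_mod_group n"
  define D where "D k = {x \<in> carrier G. group.ord G x dvd k}" for k
  define A where "A = carrier G - D (p * q)"
  define B where "B = carrier G - (D p \<union> D (q ^ b))"
  have p1: "p > 1" and q1: "q > 1"
    using assms(1,2) prime_gt_1_nat by auto
  have n0: "n > 0" using p1 q1 assms(5) by simp
  have car: "carrier G = {0..<int n}"
    using n0 by (simp add: G_def carrier_integer_mod_group)
  have finG: "finite (carrier G)" and cardG: "card (carrier G) = n"
    by (simp_all add: car)
  have sub: "D k \<subseteq> carrier G" for k
    by (auto simp: D_def)
  then have fin: "finite (D k)" for k
    using finG by (rule finite_subset)
  have cardD: "card (D k) = k" if "k dvd n" for k
    using card_ord_dvd_integer_mod_group[OF n0 that] by (simp add: D_def G_def)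
  \<comment> \<open>The divisibility criterion with \<open>k = n\<close>, where it holds
    trivially.\<close>
  have ord: "group.ord G x dvd p * q ^ b" if "x \<in> carrier G" for x
    using that ord_dvd_iff_integer_mod_group[of x n n] by (simp add: G_def flip: assms(5))
  have qb: "q * q dvd q ^ b"
    using le_imp_power_dvd[OF assms(4), of q] by (simp add: power2_eq_square)
  have pq: "p * q dvd n"
    using dvd_mult_left[OF qb] by (simp add: assms(5))
  have cop: "coprime p (q ^ b)"
    using assms(1-3) by (simp add: primes_coprime)
  have "card A = n - p * q"
    unfolding A_def by (subst card_Diff_subset) (simp_all add: fin sub cardD[OF pq] cardG)
  \<comment> \<open>Strictness comes from \<open>q < q * q \<le> q ^ b\<close>. It makes
    \<open>A\<close> nonempty, which later covers independent sets with at most one element.\<close>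
  moreover have "p * q < n"
  proof -
    have "q * q \<le> q ^ b"
      using qb q1 by (intro dvd_imp_le) auto
    moreover have "q < q * q" using q1 by simp
    ultimately have "q < q ^ b" by (rule less_le_trans[rotated])
    then show ?thesis using p1 by (simp add: assms(5))
  qed
  ultimately have cardA: "int (card A) = int n - int p * int q" and A0: "card A > 0"
    by (simp_all only: of_nat_diff less_imp_le of_nat_mult zero_less_diff)
  have "card B = n - card (D p \<union> D (q ^ b))"
    unfolding B_def by (subst card_Diff_subset) (simp_all add: fin sub cardG)
  \<comment> \<open>Inclusion-exclusion: by coprimality the overlap of \<open>D p\<close> and
    \<open>D (q ^ b)\<close> is \<open>D 1\<close>, a single element. This is the source of the
    \<open>- 1\<close> in the formula.\<close>
  moreover have "d dvd p \<and> d dvd q ^ b \<longleftrightarrow> d dvd 1" for d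
    using coprime_common_divisor[OF cop] dvd_trans one_dvd by blast
  then have "D p \<inter> D (q ^ b) = D 1"
    unfolding D_def by blast
  then have "card (D p \<union> D (q ^ b)) + 1 = p + q ^ b"
    using card_Un_Int[OF fin fin, of p "q ^ b"] cardD[of p] cardD[of "q ^ b"] cardD[of 1]
    by (simp add: assms(5))
  moreover have "card (D p \<union> D (q ^ b)) \<le> n"
    using card_mono[of "carrier G" "D p \<union> D (q ^ b)"] by (simp add: finG sub cardG)
  ultimately have cardB: "int (card B) = int n - (int q ^ b + int p - 1)"
    by (simp flip: of_nat_power)
  have indA: "independent_set (prime_coprime_graph G) A"
  proof (rule independent_prime_coprime_graph_dvd[where r = q and s = q])
    fix x assume x: "x \<in> A"
    then have "x \<in> carrier G" by (simp add: A_def)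
    from dvd_prime_times_primepowE[OF assms(1,2) ord[OF this]]
    obtain a i where ai: "group.ord G x = a * q ^ i" "a = 1 \<or> a = p"
      by blast
    \<comment> \<open>An exponent of at most 1 would make the order divide \<open>p * q\<close>,
      against \<open>x \<in> A\<close>.\<close>
    have "\<not> i \<le> 1"
    proof
      assume "i \<le> 1"
      then have "q ^ i dvd q" using le_imp_power_dvd[of i 1 q] by simp
      then have "a * q ^ i dvd p * q" using ai(2) by (intro mult_dvd_mono) auto
      then show False using x ai(1) by (auto simp: A_def D_def)
    qed
    then show "q * q dvd group.ord G x"
      using le_imp_power_dvd[of 2 i q] by (simp add: ai(1) power2_eq_square)
  qed (use q1 in \<open>auto simp: A_def\<close>)
  have indB: "independent_set (prime_coprime_graph G) B"
  proof (rule independent_prime_coprime_graph_dvd[where r = p and s = q])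
    fix x assume x: "x \<in> B"
    then have "x \<in> carrier G" by (simp add: B_def)
    from dvd_prime_times_primepowE[OF assms(1,2) ord[OF this]]
    obtain a i where ai: "group.ord G x = a * q ^ i" "a = 1 \<or> a = p" "i \<le> b"
      by blast
    \<comment> \<open>Otherwise \<open>x\<close> would lie in \<open>D (q ^ b)\<close> (if
      \<open>a = 1\<close>) or in \<open>D p\<close> (if \<open>i = 0\<close>).\<close>
    have "a = p" "i \<noteq> 0"
      using x ai by (auto simp: B_def D_def le_imp_power_dvd intro: gr0I)
    then show "p * q dvd group.ord G x"
      by (simp add: ai(1) dvd_power)
  qed (use p1 q1 in \<open>auto simp: B_def\<close>)
  have bound: "card T \<le> max (card A) (card B)"
    if T: "independent_set (prime_coprime_graph G) T" for T
  proof (cases "T \<subseteq> A \<or> T \<subseteq> B")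
    case True
    then show ?thesis
      using card_mono[of A T] card_mono[of B T] finG by (auto simp: A_def B_def)
  next
    case False
    have "T \<subseteq> carrier G"
      using T by (simp add: independent_set_def prime_coprime_graph_def)
    \<comment> \<open>\<open>u\<close> lies outside \<open>A\<close> and \<open>v\<close> outside
      \<open>B\<close>; nothing yet says whether they differ.\<close>
    with False obtain u v where u: "u \<in> T" "group.ord G u dvd p * q"
      and v: "v \<in> T" "group.ord G v dvd p \<or> group.ord G v dvd q ^ b"
      by (auto simp: A_def B_def D_def)
    \<comment> \<open>A divisor of \<open>q ^ b\<close> is coprime to \<open>p\<close>, so
      \<open>p\<close> can be cancelled from \<open>p * q\<close>.\<close>
    have gcd_q: "d dvd q" if "d dvd p * q" "d dvd q ^ b" for d
    proof -
      have "coprime p d" using coprime_divisors[OF dvd_refl that(2) cop] .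
      then have "coprime d p" by (simp add: coprime_commute)
      then show ?thesis using that(1) by (simp add: coprime_dvd_mult_right_iff)
    qed
    have "gcd (group.ord G u) (group.ord G v) dvd p \<or> gcd (group.ord G u) (group.ord G v) dvd q"
      using v(2)
    proof
      assume "group.ord G v dvd p"
      then show ?thesis using dvd_trans[OF gcd_dvd2] by blast
    next
      assume "group.ord G v dvd q ^ b"
      then show ?thesis using gcd_q dvd_trans[OF gcd_dvd1 u(2)] dvd_trans[OF gcd_dvd2] by blast
    qed
    then obtain r where r: "prime r" "gcd (group.ord G u) (group.ord G v) dvd r"
      using assms(1,2) by blast
    \<comment> \<open>Once \<open>u\<close> and \<open>v\<close> coincide, their gcd is the order of
      \<open>u\<close> itself. That order divides the prime \<open>r\<close>, so \<open>u\<close> is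
      adjacent to every other vertex and \<open>T\<close> collapses to \<open>{u}\<close>.\<close>
    have "u = v"
      using independent_setD_prime_coprime_graph[OF T u(1) v(1) r] .
    then have "gcd (group.ord G u) (group.ord G w) dvd r" for w
      using r(2) dvd_trans[OF gcd_dvd1] by simp
    then have "T \<subseteq> {u}"
      using independent_setD_prime_coprime_graph[OF T u(1) _ r(1)] by blast
    then have "card T \<le> 1" using card_mono[of "{u}" T] by simp
    then show ?thesis using A0 by simp
  qed
  have finV: "finite (pverts (prime_coprime_graph G))"
    by (simp add: prime_coprime_graph_def finG)
  have "independence_number (prime_coprime_graph G) = max (card A) (card B)"
  proof (cases "card A \<le> card B")
    case True
    then show ?thesis
      using independence_number_eqI[OF finV indB] bound by simp
  next
    case False
    then show ?thesis
      using independence_number_eqI[OF finV indA] bound by simp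
  qed
  \<comment> \<open>The larger of the two sets has the smaller complement, so the maximum turns into
    \<open>n\<close> minus a minimum.\<close>
  then show ?thesis
    using cardA cardB by (auto simp: G_def)
qed

end
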